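(* Let $w_1, w_2, d \in \mathbb{N}$, let $\chi$ be a Dirichlet character with conductor $d$, and let $k \in \mathbb{Z}_{+}$. Then, for all $x$ (equivalently, as an identity of polynomials in $x$), $$\sum_{i=0}^{dw_{1}-1}\chi(i)\,B_{k,\chi}\Big(w_{2}x+\frac{w_{2}}{w_{1}}i\Big)w_{1}^{k-1}=\sum_{i=0}^{dw_{2}-1}\chi(i)\,B_{k,\chi}\Big(w_{1}x+\frac{w_{1}}{w_{2}}i\Big)w_{2}^{k-1}.$$
   Context: $\mathbb{N}$ is the set of positive integers and $\mathbb{Z}_{+}=\mathbb{N}\cup\{0\}$. Let $p$ be a fixed prime and $\mathbb{C}_p$ the completion of an algebraic closure of $\mathbb{Q}_p$. A Dirichlet character $\chi$ with conductor $d$ is a primitive Dirichlet character modulo $d$, viewed as a $d$-periodic function on $\mathbb{Z}$ with $\chi(a)=0$ when $\gcd(a,d)>1$ (for $d=1$, $\chi$ is identically $1$, including $\chi(0)=1$); its values are regarded as elements of $\mathbb{C}_p$, and $x$ ranges over $\mathbb{C}_p$. The generalized Bernoulli polynomials $B_{n,\chi}(x)$ attached to $\chi$ are defined by the formal power series identity in $t$ $$\frac{t\sum_{i=0}^{d-1}\chi(i)e^{it}}{e^{dt}-1}\,e^{xt}=\sum_{n=0}^{\infty}B_{n,\chi}(x)\frac{t^{n}}{n!}.$$ *)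

theory Defs
  imports
    "HOL-Analysis.Abstract_Metric_Spaces"
    "HOL-Computational_Algebra.Computational_Algebra"
    "HOL-Number_Theory.Cong"
begin

definition padic_abs :: "nat \<Rightarrow> rat \<Rightarrow> real" where
  "padic_abs p r =
     (if r = 0 then 0
      else case quotient_of r of (a, b) \<Rightarrow>
        real p powi (int (multiplicity (int p) b) - int (multiplicity (int p) a)))"

locale padic_valued_field =
  fixes p :: nat and nrm :: "'a::field_char_0 \<Rightarrow> real"
  assumes prime_p: "prime p"
    and nrm_nonneg: "0 \<le> nrm x"
    and nrm_eq_0_iff: "nrm x = 0 \<longleftrightarrow> x = 0"
    and nrm_mult: "nrm (x * y) = nrm x * nrm y"
    and nrm_ultrametric: "nrm (x + y) \<le> max (nrm x) (nrm y)"
    and nrm_of_rat: "nrm (of_rat r) = padic_abs p r"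
begin

lemma nrm_1: "nrm 1 = 1"
  using nrm_mult[of 1 1] nrm_eq_0_iff[of 1] by simp

lemma nrm_uminus: "nrm (- x) = nrm x"
proof -
  have "nrm (-1) * nrm (-1) = 1"
    using nrm_mult[of "-1" "-1"] nrm_1 by simp
  hence "nrm (-1) = 1"
    using nrm_nonneg[of "-1"] by (simp add: square_eq_1_iff)
  thus ?thesis
    using nrm_mult[of "-1" x] by simp
qed

sublocale metric: Metric_space UNIV "\<lambda>x y. nrm (x - y)"
proof
  fix x y z :: 'a
  show "0 \<le> nrm (x - y)"
    by (rule nrm_nonneg)
  show "nrm (x - y) = nrm (y - x)"
    using nrm_uminus[of "x - y"] by simp
  show "nrm (x - y) = 0 \<longleftrightarrow> x = y"
    by (simp add: nrm_eq_0_iff)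
  have "nrm (x - z) \<le> max (nrm (x - y)) (nrm (y - z))"
    using nrm_ultrametric[of "x - y" "y - z"] by simp
  also have "\<dots> \<le> nrm (x - y) + nrm (y - z)"
    using nrm_nonneg[of "x - y"] nrm_nonneg[of "y - z"] by simp
  finally show "nrm (x - z) \<le> nrm (x - y) + nrm (y - z)" .
qed

(* If the ambient field is complete, this is the completion of the rationals,
   i.e. the field of p-adic numbers. *)
definition Qp :: "'a set" where
  "Qp = metric.mtopology closure_of range of_rat"

definition Qp_bar :: "'a set" where
  "Qp_bar = {x. \<exists>q. q \<noteq> 0 \<and> set (coeffs q) \<subseteq> Qp \<and> poly q x = 0}"

end

(* The libraries contain no p-adic fields. This locale says that the type 'a with nrm
   is a completion of an algebraic closure of the p-adic numbers: it is complete, and the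
   elements algebraic over Qp form an algebraically closed field that is dense.
   These conditions determine 'a with nrm up to isometric isomorphism. *)
locale padic_complex_field = padic_valued_field p nrm
  for p :: nat and nrm :: "'a::field_char_0 \<Rightarrow> real" +
  assumes complete: "metric.mcomplete"
    and Qp_bar_alg_closed:
      "\<lbrakk>set (coeffs q) \<subseteq> Qp_bar; degree q > 0\<rbrakk> \<Longrightarrow> \<exists>z\<in>Qp_bar. poly q z = 0"
    and Qp_bar_dense: "metric.mtopology closure_of Qp_bar = UNIV"

definition dirichlet_character :: "nat \<Rightarrow> (int \<Rightarrow> 'a::field) \<Rightarrow> bool" where
  "dirichlet_character d chi \<longleftrightarrow>
     d > 0 \<and> chi 1 = 1 \<and>
     (\<forall>a b. chi (a * b) = chi a * chi b) \<and>
     (\<forall>a. chi (a + int d) = chi a) \<and>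
     (\<forall>a. \<not> coprime a (int d) \<longrightarrow> chi a = 0)"

definition primitive_dirichlet_character :: "nat \<Rightarrow> (int \<Rightarrow> 'a::field) \<Rightarrow> bool" where
  "primitive_dirichlet_character d chi \<longleftrightarrow>
     dirichlet_character d chi \<and>
     \<not> (\<exists>e \<psi>. e dvd d \<and> e < d \<and> dirichlet_character e \<psi> \<and>
           (\<forall>a. coprime a (int d) \<longrightarrow> chi a = \<psi> a))"

lemma primitive_dirichlet_character_1_iff:
  "primitive_dirichlet_character 1 chi \<longleftrightarrow> (\<forall>a. chi a = 1)"
proof
  assume "primitive_dirichlet_character 1 chi"
  hence one: "chi 1 = 1" and per: "\<And>a. chi (a + 1) = chi a"
    by (auto simp: primitive_dirichlet_character_def dirichlet_character_def)
  show "\<forall>a. chi a = 1"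
  proof
    fix a
    show "chi a = 1"
    proof (induction a rule: int_induct[where k = 1])
      case (step2 i)
      thus ?case using per[of "i - 1"] by simp
    qed (use one per in auto)
  qed
next
  assume "\<forall>a. chi a = 1"
  thus "primitive_dirichlet_character 1 chi"
    by (auto simp: primitive_dirichlet_character_def dirichlet_character_def)
qed

(* Numerator and denominator both vanish at 0 and the denominator has subdegree 1, so
   the division of formal power series is exact; see gen_bernoulli_fps_mult. *)
definition gen_bernoulli_fps :: "nat \<Rightarrow> (int \<Rightarrow> 'a::field_char_0) \<Rightarrow> 'a \<Rightarrow> 'a fps" where
  "gen_bernoulli_fps d chi x =
     (fps_X * (\<Sum>i<d. fps_const (chi (int i)) * fps_exp (of_nat i))) / (fps_exp (of_nat d) - 1)
       * fps_exp x"

definition gen_bernoulli :: "nat \<Rightarrow> nat \<Rightarrow> (int \<Rightarrow> 'a::field_char_0) \<Rightarrow> 'a \<Rightarrow> 'a" where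
  "gen_bernoulli n d chi x = fact n * fps_nth (gen_bernoulli_fps d chi x) n"

lemma gen_bernoulli_fps_mult:
  fixes chi :: "int \<Rightarrow> 'a::field_char_0"
  assumes "d > 0"
  shows "Abs_fps (\<lambda>n. gen_bernoulli n d chi x / fact n) * (fps_exp (of_nat d) - 1) =
           fps_X * (\<Sum>i<d. fps_const (chi (int i)) * fps_exp (of_nat i)) * fps_exp x"
proof -
  let ?D = "fps_exp (of_nat d) - 1 :: 'a fps"
  let ?N = "fps_X * (\<Sum>i<d. fps_const (chi (int i)) * fps_exp (of_nat i))"
  have nth1: "fps_nth ?D 1 \<noteq> 0"
    using assms by simp
  hence nz: "?D \<noteq> 0"
    by auto
  have sub: "subdegree ?D \<le> 1"
    using nth1 by (rule subdegree_leI)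
  have "?D dvd ?N"
  proof (cases "?N = 0")
    case False
    have "1 \<le> subdegree ?N"
      using False by (intro subdegree_geI) auto
    with sub have "subdegree ?D \<le> subdegree ?N"
      by simp
    thus ?thesis
      using False nz by (simp add: fps_dvd_iff)
  qed simp
  hence "?N / ?D * ?D = ?N"
    by (rule dvd_div_mult_self)
  moreover have "Abs_fps (\<lambda>n. gen_bernoulli n d chi x / fact n) = ?N / ?D * fps_exp x"
    by (simp add: fps_eq_iff gen_bernoulli_def gen_bernoulli_fps_def)
  ultimately show ?thesis
    by (metis (no_types, lifting) mult.assoc mult.commute)
qed

end

theory Submission
  imports Defs
begin

text \<open>
  The right-hand side arises from the left-hand side by exchanging \<open>w1\<close> and \<open>w2\<close>, so it is enough to
  find a visibly symmetric description of one side. Write \<open>N(t) = \<Sum>i<d. chi(i) e^(it)\<close>, so that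
  \<open>t N(t) e^(yt) / (e^(dt) - 1)\<close> generates the generalized Bernoulli polynomials at \<open>y\<close>. Replacing
  \<open>t\<close> by \<open>w1 t\<close> and dividing by \<open>w1\<close> produces the powers of \<open>w1\<close> and clears the denominator in the shift
  \<open>(w2/w1) i\<close>: the exponential generating function of the left-hand side over \<open>k\<close> is
  \<open>t N(w1 t) e^(w1 w2 x t) / (e^(d w1 t) - 1)\<close> times \<open>\<Sum>i<d w1. chi(i) e^(w2 i t)\<close>.
  As \<open>chi\<close> has period \<open>d\<close>, this last sum is a geometric sum of \<open>w1\<close> translates of \<open>N(w2 t)\<close>, namely
  \<open>N(w2 t) (e^(d w1 w2 t) - 1) / (e^(d w2 t) - 1)\<close>. Together this gives
  \<open>t N(w1 t) N(w2 t) (e^(d w1 w2 t) - 1) e^(w1 w2 x t) / ((e^(d w1 t) - 1) (e^(d w2 t) - 1))\<close>,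
  which is symmetric in \<open>w1\<close> and \<open>w2\<close>. Below, the denominators are multiplied out and cancelled
  at the end, since the ring of formal power series has no zero divisors.
\<close>

definition scaled_char_sum :: "nat \<Rightarrow> (int \<Rightarrow> 'a::field_char_0) \<Rightarrow> nat \<Rightarrow> 'a fps" where
  "scaled_char_sum d chi w = (\<Sum>i<d. fps_const (chi (int i)) * fps_exp (of_nat (w * i)))"

lemma sum_lessThan_add_split:
  fixes g :: "nat \<Rightarrow> 'a::comm_monoid_add"
  shows "sum g {..<m + n} = sum g {..<m} + (\<Sum>i<n. g (m + i))"
  by (induction n) (simp_all add: add.assoc)

lemma fps_exp_of_nat_minus_1_nonzero:
  assumes "n > 0"
  shows "fps_exp (of_nat n) - (1 :: 'a::field_char_0 fps) \<noteq> 0"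
proof
  assume "fps_exp (of_nat n) - (1 :: 'a fps) = 0"
  hence "fps_nth (fps_exp (of_nat n) - (1 :: 'a fps)) 1 = 0"
    by simp
  thus False
    using assms by simp
qed

text \<open>
  Each block of \<open>d\<close> consecutive terms is the first block times a power of \<open>e^(dbt)\<close>, so the
  sum over \<open>a\<close> blocks is geometric and telescopes after multiplication by \<open>e^(dbt) - 1\<close>.
\<close>

lemma periodic_scaled_char_sum:
  fixes chi :: "int \<Rightarrow> 'a::field_char_0"
  assumes periodic: "\<And>i. chi (i + int d) = chi i"
  shows "scaled_char_sum (d * a) chi b * (fps_exp (of_nat (d * b)) - 1) =
           scaled_char_sum d chi b * (fps_exp (of_nat (d * a * b)) - 1)"
proof (induction a)
  case 0
  show ?case by (simp add: scaled_char_sum_def)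
next
  case (Suc a)
  have per: "chi (int (d * a + i)) = chi (int i)" for i
  proof (induction a)
    case (Suc a)
    have "chi (int (d * Suc a + i)) = chi (int (d * a + i) + int d)"
      by (simp add: algebra_simps)
    with Suc periodic show ?case by simp
  qed simp
  have "scaled_char_sum (d * Suc a) chi b = scaled_char_sum (d * a) chi b +
      (\<Sum>i<d. fps_const (chi (int (d * a + i))) * fps_exp (of_nat (b * (d * a + i))))"
    unfolding scaled_char_sum_def mult_Suc_right add.commute[of d "d * a"]
    by (rule sum_lessThan_add_split)
  also have "(\<Sum>i<d. fps_const (chi (int (d * a + i))) * fps_exp (of_nat (b * (d * a + i)))) =
      scaled_char_sum d chi b * fps_exp (of_nat (d * a * b))"
    unfolding scaled_char_sum_def sum_distrib_right per
    by (intro sum.cong refl)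
      (simp add: fps_exp_add_mult [symmetric] mult.assoc algebra_simps)
  finally have split: "scaled_char_sum (d * Suc a) chi b = scaled_char_sum (d * a) chi b +
      scaled_char_sum d chi b * fps_exp (of_nat (d * a * b))" .
  have exp: "fps_exp (of_nat (d * Suc a * b)) =
      fps_exp (of_nat (d * a * b)) * (fps_exp (of_nat (d * b)) :: 'a fps)"
    by (simp add: fps_exp_add_mult [symmetric] algebra_simps)
  show ?case
    unfolding split exp distrib_right Suc.IH by (simp add: algebra_simps)
qed

text \<open>This is the defining identity of the polynomials with \<open>a t\<close> substituted for \<open>t\<close>.\<close>

lemma gen_bernoulli_fps_mult_scaled:
  fixes chi :: "int \<Rightarrow> 'a::field_char_0"
  assumes "d > 0"
  shows "Abs_fps (\<lambda>n. of_nat a ^ n * gen_bernoulli n d chi y / fact n) *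
           (fps_exp (of_nat (d * a)) - 1) =
         fps_const (of_nat a) * fps_X * scaled_char_sum d chi a * fps_exp (of_nat a * y)"
proof -
  let ?c = "fps_const (of_nat a :: 'a) * fps_X"
  let ?B = "Abs_fps (\<lambda>n. gen_bernoulli n d chi y / fact n)"
  have B: "Abs_fps (\<lambda>n. of_nat a ^ n * gen_bernoulli n d chi y / fact n) = ?B oo ?c"
    by (simp add: fps_compose_linear fps_eq_iff)
  have "(?B * (fps_exp (of_nat d) - 1)) oo ?c =
      (fps_X * (\<Sum>i<d. fps_const (chi (int i)) * fps_exp (of_nat i)) * fps_exp y) oo ?c"
    using gen_bernoulli_fps_mult[OF assms, of chi y] by simp
  hence "(?B oo ?c) * (fps_exp (of_nat a * of_nat d) - 1) =
      ?c * scaled_char_sum d chi a * fps_exp (of_nat a * y)"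
    by (simp add: scaled_char_sum_def fps_compose_mult_distrib fps_compose_sub_distrib
        fps_compose_sum_distrib)
  thus ?thesis
    unfolding B by (simp only: of_nat_mult mult.commute[of "of_nat d"])
qed

definition char_bernoulli_sum :: "nat \<Rightarrow> (int \<Rightarrow> 'a::field_char_0) \<Rightarrow> 'a \<Rightarrow> nat \<Rightarrow> nat \<Rightarrow> nat \<Rightarrow> 'a"
  where "char_bernoulli_sum d chi x a b n =
    (\<Sum>i<d * a. chi (int i) *
        gen_bernoulli n d chi (of_nat b * x + of_nat b / of_nat a * of_nat i) *
        of_nat a powi (int n - 1))"

text \<open>
  The right-hand side and the product of the two denominators are both symmetric in \<open>a\<close> and \<open>b\<close>,
  hence so is the generating function.
\<close>

lemma char_bernoulli_sum_generating_function:
  fixes chi :: "int \<Rightarrow> 'a::field_char_0"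
  assumes "d > 0" and "a > 0" and periodic: "\<And>i. chi (i + int d) = chi i"
  shows "Abs_fps (\<lambda>n. char_bernoulli_sum d chi x a b n / fact n) *
           ((fps_exp (of_nat (d * a)) - 1) * (fps_exp (of_nat (d * b)) - 1)) =
         fps_X * scaled_char_sum d chi a * scaled_char_sum d chi b *
           (fps_exp (of_nat (d * a * b)) - 1) * fps_exp (of_nat (a * b) * x)"
proof -
  let ?y = "\<lambda>i. of_nat b * x + of_nat b / of_nat a * of_nat i :: 'a"
  let ?B = "\<lambda>i. Abs_fps (\<lambda>n. of_nat a ^ n * gen_bernoulli n d chi (?y i) / fact n)"
  let ?D = "\<lambda>w. fps_exp (of_nat (d * w)) - 1 :: 'a fps"
  let ?N = "scaled_char_sum d chi"
  let ?E = "fps_exp (of_nat (a * b) * x)"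
  have "Abs_fps (\<lambda>n. char_bernoulli_sum d chi x a b n / fact n) =
      (\<Sum>i<d * a. fps_const (chi (int i) / of_nat a) * ?B i)"
    using \<open>a > 0\<close>
    by (simp add: fps_eq_iff fps_sum_nth char_bernoulli_sum_def sum_divide_distrib
        power_int_diff mult_ac)
  hence "Abs_fps (\<lambda>n. char_bernoulli_sum d chi x a b n / fact n) * ?D a =
      (\<Sum>i<d * a. fps_const (chi (int i) / of_nat a) * (?B i * ?D a))"
    by (simp add: sum_distrib_right mult.assoc)
  also have "\<dots> = (\<Sum>i<d * a. fps_X * ?N a * ?E *
      (fps_const (chi (int i)) * fps_exp (of_nat (b * i))))"
  proof (intro sum.cong refl)
    fix i
    have const: "fps_const (chi (int i) / of_nat a) * fps_const (of_nat a) = fps_const (chi (int i))"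
      using \<open>a > 0\<close> by simp
    have "of_nat a * ?y i = of_nat (a * b) * x + of_nat (b * i)"
      using \<open>a > 0\<close> by (simp add: field_simps)
    hence exp: "fps_exp (of_nat a * ?y i) = ?E * fps_exp (of_nat (b * i))"
      by (simp only: fps_exp_add_mult)
    have "fps_const (chi (int i) / of_nat a) * (?B i * ?D a) =
        (fps_const (chi (int i) / of_nat a) * fps_const (of_nat a)) *
          (fps_X * ?N a * fps_exp (of_nat a * ?y i))"
      unfolding gen_bernoulli_fps_mult_scaled[OF \<open>d > 0\<close>] by (simp only: mult.assoc)
    also have "\<dots> = fps_X * ?N a * ?E * (fps_const (chi (int i)) * fps_exp (of_nat (b * i)))"
      unfolding const exp by (simp only: mult_ac)
    finally show "fps_const (chi (int i) / of_nat a) * (?B i * ?D a) =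
        fps_X * ?N a * ?E * (fps_const (chi (int i)) * fps_exp (of_nat (b * i)))" .
  qed
  also have "\<dots> = fps_X * ?N a * ?E * scaled_char_sum (d * a) chi b"
    by (simp only: scaled_char_sum_def sum_distrib_left)
  finally have "Abs_fps (\<lambda>n. char_bernoulli_sum d chi x a b n / fact n) * (?D a * ?D b) =
      fps_X * ?N a * ?E * (scaled_char_sum (d * a) chi b * ?D b)"
    by (simp only: mult.assoc [symmetric])
  also have "\<dots> = fps_X * ?N a * ?N b * (fps_exp (of_nat (d * a * b)) - 1) * ?E"
    unfolding periodic_scaled_char_sum[where chi = chi, OF periodic] by (simp only: mult_ac)
  finally show ?thesis .
qed

lemma char_bernoulli_sum_commute:
  fixes chi :: "int \<Rightarrow> 'a::field_char_0"
  assumes "d > 0" and "a > 0" and "b > 0" and "\<And>i. chi (i + int d) = chi i"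
  shows "char_bernoulli_sum d chi x a b n = char_bernoulli_sum d chi x b a n"
proof -
  let ?G = "\<lambda>a b. Abs_fps (\<lambda>n. char_bernoulli_sum d chi x a b n / fact n)"
  let ?D = "\<lambda>w. fps_exp (of_nat (d * w)) - 1 :: 'a fps"
  have "?G a b * (?D a * ?D b) = ?G b a * (?D a * ?D b)"
    using char_bernoulli_sum_generating_function[where chi = chi, OF assms(1,2,4), of x b]
      char_bernoulli_sum_generating_function[where chi = chi, OF assms(1,3,4), of x a]
    by (simp only: mult_ac)
  moreover have "?D a * ?D b \<noteq> 0"
    using assms by (intro no_zero_divisors fps_exp_of_nat_minus_1_nonzero) auto
  ultimately have "?G a b = ?G b a"
    by (rule iffD1[OF mult_right_cancel, rotated])
  thus ?thesis
    by (simp add: fps_eq_iff)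
qed

theorem theorem3:
  fixes p w1 w2 d k :: nat
    and nrm :: "'a::field_char_0 \<Rightarrow> real"
    and chi :: "int \<Rightarrow> 'a"
    and x :: 'a
  assumes "padic_complex_field p nrm"
    and "w1 > 0" and "w2 > 0" and "d > 0"
    and "primitive_dirichlet_character d chi"
  shows
    "(\<Sum>i<d * w1. chi (int i) *
        gen_bernoulli k d chi (of_nat w2 * x + of_nat w2 / of_nat w1 * of_nat i) *
        of_nat w1 powi (int k - 1)) =
     (\<Sum>i<d * w2. chi (int i) *
        gen_bernoulli k d chi (of_nat w1 * x + of_nat w1 / of_nat w2 * of_nat i) *
        of_nat w2 powi (int k - 1))"
proof -
  have "chi (i + int d) = chi i" for i
    using assms(5) by (simp add: primitive_dirichlet_character_def dirichlet_character_def)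
  from char_bernoulli_sum_commute[where chi = chi, OF assms(4,2,3) this] show ?thesis
    by (simp only: char_bernoulli_sum_def)
qed

end
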